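(* Let $X$ be a non-empty set and let $\Phi$ be a non-empty set of functions $\phi\colon X\to\mathbb{R}$, inducing the preorder $x\preccurlyeq y$ if and only if $\phi(x)\le\phi(y)$ for all $\phi\in\Phi$. Assume that $\Phi$ is endowed with a topology which makes it a Polish space and such that for every $x\in X$ the function $\Phi\to\mathbb{R}$, $\phi\mapsto\phi(x)$, is lower semicontinuous. Let $\psi\colon X\to(-\infty,\infty]$ be a function with sublevel sets $A_s:=\{x\in X\colon\psi(x)\le s\}$, $s\in\mathbb{R}$. Define $\alpha_{\min},\alpha_{\min}^+\colon\mathbb{R}\times\Phi\to[-\infty,\infty]$ by $$\alpha_{\min}(s,\phi):=\sup_{x\in A_s}\phi(x),\qquad \alpha_{\min}^+(s,\phi):=\inf_{t>s}\alpha_{\min}(t,\phi).$$ Then the following statements are equivalent: (i) $\psi$ is monotone and has countably upwards directed sublevel sets. (ii) There exists a function $\alpha\colon\mathbb{R}\times\Phi\to[-\infty,\infty]$ which is non-decreasing in the first argument and countably stable in the second argument such that $$\psi(x)=\inf\Big\{s\in\mathbb{R}\colon \sup_{\phi\in\Phi}\{\phi(x)-\alpha(s,\phi)\}\le 0\Big\}\quad\text{for all }x\in X,$$ and the infimum is attained for all $x\in X$ with $\psi(x)<\infty$. (iii) The function $\alpha_{\min}$ is countably stable in the second argument and $$\psi(x)=\inf\Big\{s\in\mathbb{R}\colon \sup_{\phi\in\Phi}\{\phi(x)-\alpha_{\min}(s,\phi)\}\le 0\Big\}\quad\text{for all }x\in X,$$ and the infimum is attained for all $x\in X$ with $\psi(x)<\infty$.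 (iv) The function $\alpha_{\min}^+$ is countably stable in the second argument and $$\psi(x)=\inf\Big\{s\in\mathbb{R}\colon \sup_{\phi\in\Phi}\{\phi(x)-\alpha_{\min}^+(s,\phi)\}\le 0\Big\}\quad\text{for all }x\in X,$$ and the infimum is attained for all $x\in X$ with $\psi(x)<\infty$. (v) The function $\alpha_{\min}^+$ is countably stable in the second argument and $$\psi(x)=\sup_{\phi\in\Phi}G(\phi(x),\phi)\quad\text{for all }x\in X,$$ where $G\colon\mathbb{R}\times\Phi\to[-\infty,\infty]$, $G(t,\phi):=\inf\{s\in\mathbb{R}\colon t\le\alpha_{\min}^+(s,\phi)\}$.
   Context: Conventions: $\inf\emptyset=\infty$, $\sup\emptyset=-\infty$; for $r\in\mathbb{R}$, $r-\infty=-\infty$ and $r-(-\infty)=\infty$. A function $\psi\colon X\to(-\infty,\infty]$ is monotone if $x\preccurlyeq y$ implies $\psi(x)\le\psi(y)$. A set $A\subset X$ is countably upwards directed if for every non-empty countable subset $Y\subset A$ there exists $y^\ast\in A$ with $y\preccurlyeq y^\ast$ for all $y\in Y$; $\psi$ has countably upwards directed sublevel sets if $A_s$ is countably upwards directed for every $s\in\mathbb{R}$. A function $\alpha\colon\Phi\to[-\infty,\infty]$ is countably stable if for every non-empty countable subset $Y\subset X$ with $\sup_{y\in Y}\phi(y)\le\alpha(\phi)$ for all $\phi\in\Phi$, there exists $y^\ast\in X$ with $y\preccurlyeq y^\ast$ for all $y\in Y$ and $\phi(y^\ast)\le\alpha(\phi)$ for all $\phi\in\Phi$. A function $\alpha$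 on $\mathbb{R}\times\Phi$ is countably stable in the second argument if $\alpha(s,\cdot)$ is countably stable for every $s\in\mathbb{R}$. A function $f$ on a topological space is lower semicontinuous if $\{f\le s\}$ is closed for every $s\in\mathbb{R}$. *)

theory Defs
  imports "HOL-Analysis.Analysis"
begin

text \<open>
  The non-empty set \<open>X\<close> is the universe of the type \<^typ>\<open>'a\<close>. Functions on \<open>\<Phi>\<close> are total functions
  on \<^typ>\<open>'a \<Rightarrow> real\<close> of which only the values on \<open>\<Phi>\<close> are used. The conventions
  \<open>inf \<emptyset> = \<infinity>\<close>, \<open>sup \<emptyset> = -\<infinity>\<close>, \<open>r - \<infinity> = -\<infinity>\<close> and \<open>r - (-\<infinity>) = \<infinity>\<close> for real \<open>r\<close> are those
  of \<^typ>\<open>ereal\<close>.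
\<close>

definition induced_le :: "('a \<Rightarrow> real) set \<Rightarrow> 'a \<Rightarrow> 'a \<Rightarrow> bool" where
  "induced_le \<Phi> x y \<longleftrightarrow> (\<forall>\<phi>\<in>\<Phi>. \<phi> x \<le> \<phi> y)"

text \<open>The class \<^class>\<open>polish_space\<close> does not apply, since the topology lives on a set of functions
  and is unrelated to the product topology on \<^typ>\<open>'a \<Rightarrow> real\<close>.\<close>

definition polish_topology :: "'b topology \<Rightarrow> bool" where
  "polish_topology T \<longleftrightarrow> completely_metrizable_space T \<and> separable_space T"

definition lower_semicontinuous_map :: "'b topology \<Rightarrow> ('b \<Rightarrow> real) \<Rightarrow> bool" where
  "lower_semicontinuous_map T f \<longleftrightarrow> (\<forall>s. closedin T {p \<in> topspace T. f p \<le> s})"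

definition monotone_wrt :: "('a \<Rightarrow> real) set \<Rightarrow> ('a \<Rightarrow> ereal) \<Rightarrow> bool" where
  "monotone_wrt \<Phi> \<psi> \<longleftrightarrow> (\<forall>x y. induced_le \<Phi> x y \<longrightarrow> \<psi> x \<le> \<psi> y)"

definition countably_upwards_directed :: "('a \<Rightarrow> real) set \<Rightarrow> 'a set \<Rightarrow> bool" where
  "countably_upwards_directed \<Phi> A \<longleftrightarrow>
     (\<forall>Y. Y \<subseteq> A \<and> Y \<noteq> {} \<and> countable Y \<longrightarrow> (\<exists>y'\<in>A. \<forall>y\<in>Y. induced_le \<Phi> y y'))"

definition sublevel :: "('a \<Rightarrow> ereal) \<Rightarrow> real \<Rightarrow> 'a set" where
  "sublevel \<psi> s = {x. \<psi> x \<le> ereal s}"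

definition countably_stable ::
  "('a \<Rightarrow> real) set \<Rightarrow> (('a \<Rightarrow> real) \<Rightarrow> ereal) \<Rightarrow> bool" where
  "countably_stable \<Phi> \<alpha> \<longleftrightarrow>
     (\<forall>Y. Y \<noteq> {} \<and> countable Y \<and> (\<forall>\<phi>\<in>\<Phi>. (SUP y\<in>Y. ereal (\<phi> y)) \<le> \<alpha> \<phi>) \<longrightarrow>
       (\<exists>y'. (\<forall>y\<in>Y. induced_le \<Phi> y y') \<and> (\<forall>\<phi>\<in>\<Phi>. ereal (\<phi> y') \<le> \<alpha> \<phi>)))"

definition countably_stable_snd ::
  "('a \<Rightarrow> real) set \<Rightarrow> (real \<Rightarrow> ('a \<Rightarrow> real) \<Rightarrow> ereal) \<Rightarrow> bool" where
  "countably_stable_snd \<Phi> \<alpha> \<longleftrightarrow> (\<forall>s. countably_stable \<Phi> (\<alpha> s))"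

definition alpha_min :: "('a \<Rightarrow> ereal) \<Rightarrow> real \<Rightarrow> ('a \<Rightarrow> real) \<Rightarrow> ereal" where
  "alpha_min \<psi> s \<phi> = (SUP x\<in>sublevel \<psi> s. ereal (\<phi> x))"

definition alpha_min_plus :: "('a \<Rightarrow> ereal) \<Rightarrow> real \<Rightarrow> ('a \<Rightarrow> real) \<Rightarrow> ereal" where
  "alpha_min_plus \<psi> s \<phi> = (INF t\<in>{s<..}. alpha_min \<psi> t \<phi>)"

definition G_fun :: "('a \<Rightarrow> ereal) \<Rightarrow> real \<Rightarrow> ('a \<Rightarrow> real) \<Rightarrow> ereal" where
  "G_fun \<psi> t \<phi> = (INF s\<in>{s. ereal t \<le> alpha_min_plus \<psi> s \<phi>}. ereal s)"

definition acceptance_levels ::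
  "('a \<Rightarrow> real) set \<Rightarrow> (real \<Rightarrow> ('a \<Rightarrow> real) \<Rightarrow> ereal) \<Rightarrow> 'a \<Rightarrow> real set" where
  "acceptance_levels \<Phi> \<alpha> x = {s. (SUP \<phi>\<in>\<Phi>. ereal (\<phi> x) - \<alpha> s \<phi>) \<le> 0}"

definition inf_represents ::
  "('a \<Rightarrow> real) set \<Rightarrow> (real \<Rightarrow> ('a \<Rightarrow> real) \<Rightarrow> ereal) \<Rightarrow> ('a \<Rightarrow> ereal) \<Rightarrow> bool" where
  "inf_represents \<Phi> \<alpha> \<psi> \<longleftrightarrow>
     (\<forall>x. \<psi> x = (INF s\<in>acceptance_levels \<Phi> \<alpha> x. ereal s)) \<and>
     (\<forall>x. \<psi> x < \<infinity> \<longrightarrow>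
        (\<exists>s\<in>acceptance_levels \<Phi> \<alpha> x. ereal s = (INF s\<in>acceptance_levels \<Phi> \<alpha> x. ereal s)))"

end

theory Submission
  imports Defs
begin

text \<open>
  In each of (ii)--(iv), the infimum condition amounts to saying that the sublevel set
  \<open>A\<^sub>s\<close> is \<open>{x. \<forall>\<phi>\<in>\<Phi>. \<phi> x \<le> \<alpha> s \<phi>}\<close> for every \<open>s\<close>. The only step that needs the topology is that
  (i) gives this identity for \<open>alpha_min\<close>: since \<open>\<Phi>\<close> is second countable and evaluations are lower
  semicontinuous, the supremum over \<open>A\<^sub>s\<close> is attained along one countable subset, simultaneously
  for all \<open>\<phi>\<close>, and an upper bound of that subset in \<open>A\<^sub>s\<close> dominates every point under the supremum.
  For the dual representation (v), \<open>alpha_min_plus\<close> is right-continuous in \<open>s\<close>, so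
  \<open>G t \<phi> \<le> s\<close> holds exactly when \<open>t \<le> alpha_min_plus s \<phi>\<close>.
\<close>

section \<open>Countable bases and countable suprema\<close>

text \<open>The base consists of the balls of radius 1/(n+1) centred in a countable dense set.
  Inside a ball of radius r about x, a radius e < r/2 and a dense point within e of x give such a
  ball that contains x and stays inside.\<close>

lemma metrizable_separable_imp_second_countable:
  assumes "metrizable_space T" and "separable_space T"
  shows "second_countable T"
proof -
  obtain M d where M: "Metric_space M d" and T: "T = Metric_space.mtopology M d"
    using assms(1) unfolding metrizable_space_def by blast
  interpret Metric_space M d by (fact M)
  obtain D where D: "countable D" "D \<subseteq> M" "T closure_of D = M"
    using assms(2) unfolding separable_space_def T by auto
  define \<B> where "\<B> = (\<lambda>(a, n). mball a (inverse (real (Suc n)))) ` (D \<times> UNIV)"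
  have "\<exists>V\<in>\<B>. x \<in> V \<and> V \<subseteq> U" if U: "openin T U" and x: "x \<in> U" for U x
  proof -
    obtain r where r: "r > 0" "mball x r \<subseteq> U" and xM: "x \<in> M"
      using U x unfolding T openin_mtopology by blast
    obtain n where n: "inverse (real (Suc n)) < r / 2"
      using reals_Archimedean r(1) half_gt_zero by blast
    define e where "e = inverse (real (Suc n))"
    have e: "e > 0" "e < r / 2" using n by (auto simp: e_def)
    have "x \<in> T closure_of D" using D(3) xM by simp
    then obtain a where a: "a \<in> D" "a \<in> mball x e"
      using e(1) unfolding T metric_closure_of by blast
    have "mball a e \<subseteq> U"
    proof
      fix z assume z: "z \<in> mball a e"
      have "d x z \<le> d x a + d a z"
        using z a xM by (intro triangle) auto
      also have "\<dots> < r" using z a e by auto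
      finally show "z \<in> U" using r(2) z xM by auto
    qed
    moreover have "x \<in> mball a e" using a xM by (auto simp: commute)
    moreover have "mball a e \<in> \<B>" using a(1) by (auto simp: \<B>_def e_def)
    ultimately show ?thesis by blast
  qed
  moreover have "countable \<B>" using D(1) by (auto simp: \<B>_def)
  moreover have "\<forall>V\<in>\<B>. openin T V" by (auto simp: \<B>_def T)
  ultimately show ?thesis unfolding second_countable_def by meson
qed

text \<open>A Lindelof-type argument. Lower semicontinuity makes each set where \<open>f y\<close>
  exceeds q open, so a strict lower bound at p is witnessed by a rational q on a whole basic set
  around p. One witness y for each pair of a basic set and a rational suffices.\<close>

lemma countable_subset_same_SUP:
  fixes A :: "'b set" and f :: "'b \<Rightarrow> 'c \<Rightarrow> real"
  assumes "second_countable T" and lsc: "\<And>y. lower_semicontinuous_map T (f y)"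
  obtains Y where "Y \<subseteq> A" and "countable Y"
    and "\<And>p. p \<in> topspace T \<Longrightarrow> (SUP y\<in>A. ereal (f y p)) = (SUP y\<in>Y. ereal (f y p))"
proof -
  obtain \<B> where \<B>: "countable \<B>"
    and base: "\<And>U p. openin T U \<Longrightarrow> p \<in> U \<Longrightarrow> \<exists>V\<in>\<B>. p \<in> V \<and> V \<subseteq> U"
    using assms(1) unfolding second_countable_def by meson
  \<comment> \<open>\<open>good V q y\<close> certifies the bound q on all of V, so the selected y
    depends on the pair (V, q) and not on the point p.\<close>
  define good where "good = (\<lambda>V q y. y \<in> A \<and> (\<forall>p\<in>V. f y p > q))"
  define Y where "Y = (\<lambda>(V, q). SOME y. good V q y) ` {(V, q) \<in> \<B> \<times> \<rat>. \<exists>y. good V q y}"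
  have some: "good V q (SOME y. good V q y)" if "\<exists>y. good V q y" for V q
    using that by (rule someI_ex)
  have YA: "Y \<subseteq> A" using some by (auto simp: Y_def good_def)
  have Y: "countable Y"
    unfolding Y_def
    by (intro countable_image countable_subset[OF _ countable_SIGMA[OF \<B> countable_rat]]) auto
  have "(SUP y\<in>A. ereal (f y p)) = (SUP y\<in>Y. ereal (f y p))" if p: "p \<in> topspace T" for p
  proof (rule antisym)
    show "(SUP y\<in>A. ereal (f y p)) \<le> (SUP y\<in>Y. ereal (f y p))"
    proof (rule SUP_least, rule dense_le)
      fix y z assume y: "y \<in> A" and z: "z < ereal (f y p)"
      \<comment> \<open>As z is an extended real and may be -\<infinity>, a real w is inserted
        before the rational q is chosen.\<close>
      obtain w where w: "z < ereal w" "w < f y p"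
        using ereal_dense2[OF z] by auto
      obtain q where q: "q \<in> \<rat>" "w < q" "q < f y p"
        using Rats_dense_in_real[OF w(2)] by blast
      have "topspace T - {p \<in> topspace T. f y p \<le> q} = {p \<in> topspace T. q < f y p}"
        by auto
      moreover have "closedin T {p \<in> topspace T. f y p \<le> q}"
        using lsc[of y] by (simp add: lower_semicontinuous_map_def)
      ultimately have "openin T {p \<in> topspace T. q < f y p}"
        by (metis closedin_def)
      then obtain V where V: "V \<in> \<B>" "p \<in> V" "V \<subseteq> {p \<in> topspace T. q < f y p}"
        using base p q(3) by blast
      have ex: "\<exists>y. good V q y" using y V(3) by (auto simp: good_def)
      define y' where "y' = (SOME y. good V q y)"
      have "y' \<in> Y" using ex V(1) q(1) by (force simp: Y_def y'_def)
      moreover have "q < f y' p"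
        using some[OF ex] V(2) by (auto simp: good_def y'_def)
      moreover have "z \<le> ereal q"
        using w(1) q(2) by (meson ereal_less_eq(3) less_imp_le order_trans)
      ultimately show "z \<le> (SUP y\<in>Y. ereal (f y p))"
        by (meson SUP_upper2 ereal_less_eq(3) less_imp_le order_trans)
    qed
    show "(SUP y\<in>Y. ereal (f y p)) \<le> (SUP y\<in>A. ereal (f y p))"
      using YA by (rule SUP_subset_mono) simp
  qed
  then show thesis using that YA Y by blast
qed

section \<open>From the infimum formula to sublevel sets\<close>

lemma ereal_diff_nonpos_iff: "ereal r - a \<le> 0 \<longleftrightarrow> ereal r \<le> a"
  by (cases a) auto

lemma mem_acceptance_levels_iff:
  "s \<in> acceptance_levels \<Phi> \<alpha> x \<longleftrightarrow> (\<forall>\<phi>\<in>\<Phi>. ereal (\<phi> x) \<le> \<alpha> s \<phi>)"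
  by (simp add: acceptance_levels_def SUP_le_iff ereal_diff_nonpos_iff)

text \<open>Working form of \<open>inf_represents\<close>: the infimum formula and its attainment
  are merged into one condition in which no infimum occurs.\<close>

definition represents_sublevels ::
  "('a \<Rightarrow> real) set \<Rightarrow> (real \<Rightarrow> ('a \<Rightarrow> real) \<Rightarrow> ereal) \<Rightarrow> ('a \<Rightarrow> ereal) \<Rightarrow> bool" where
  "represents_sublevels \<Phi> \<alpha> \<psi> \<longleftrightarrow>
     (\<forall>s x. x \<in> sublevel \<psi> s \<longleftrightarrow> (\<forall>\<phi>\<in>\<Phi>. ereal (\<phi> x) \<le> \<alpha> s \<phi>))"

text \<open>Attainment makes a finite \<psi> x itself an acceptance level, and monotonicity of
  \<alpha> passes this on to every larger s. Conversely, the acceptance levels are exactly the reals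
  above \<psi> x; excluding -\<infinity> ensures that they have a minimum whenever \<psi> x <
  \<infinity>.\<close>

lemma inf_represents_iff_represents_sublevels:
  assumes mono: "\<forall>\<phi>\<in>\<Phi>. mono (\<lambda>s. \<alpha> s \<phi>)" and psi: "\<And>x. \<psi> x \<noteq> -\<infinity>"
  shows "inf_represents \<Phi> \<alpha> \<psi> \<longleftrightarrow> represents_sublevels \<Phi> \<alpha> \<psi>"
proof
  assume rep: "inf_represents \<Phi> \<alpha> \<psi>"
  have eq: "\<psi> x = (INF s\<in>acceptance_levels \<Phi> \<alpha> x. ereal s)" for x
    using rep by (simp add: inf_represents_def)
  show "represents_sublevels \<Phi> \<alpha> \<psi>"
    unfolding represents_sublevels_def
  proof (intro allI iffI)
    fix s x assume "x \<in> sublevel \<psi> s"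
    then have le: "\<psi> x \<le> ereal s" by (simp add: sublevel_def)
    then have "\<psi> x < \<infinity>" by auto
    then obtain r where r: "r \<in> acceptance_levels \<Phi> \<alpha> x" "ereal r = \<psi> x"
      using rep eq unfolding inf_represents_def by metis
    have "r \<le> s" using le r(2) by (metis ereal_less_eq(3))
    then show "\<forall>\<phi>\<in>\<Phi>. ereal (\<phi> x) \<le> \<alpha> s \<phi>"
      using r(1) mono unfolding mem_acceptance_levels_iff by (meson monoD order_trans)
  next
    fix s x assume "\<forall>\<phi>\<in>\<Phi>. ereal (\<phi> x) \<le> \<alpha> s \<phi>"
    then show "x \<in> sublevel \<psi> s"
      by (simp add: sublevel_def eq[of x] INF_lower mem_acceptance_levels_iff)
  qed
next
  assume "represents_sublevels \<Phi> \<alpha> \<psi>"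
  then have acc: "acceptance_levels \<Phi> \<alpha> x = {s. \<psi> x \<le> ereal s}" for x
    by (auto simp: represents_sublevels_def mem_acceptance_levels_iff sublevel_def)
  have inf: "(INF s\<in>{s. \<psi> x \<le> ereal s}. ereal s) = \<psi> x" for x
  proof (rule antisym)
    show "(INF s\<in>{s. \<psi> x \<le> ereal s}. ereal s) \<le> \<psi> x"
      by (rule ereal_le_real) (auto intro: INF_lower)
  qed (auto intro: INF_greatest)
  have "\<exists>s. \<psi> x \<le> ereal s \<and> ereal s = \<psi> x" if "\<psi> x < \<infinity>" for x
    using that psi[of x] by (cases "\<psi> x") auto
  then show "inf_represents \<Phi> \<alpha> \<psi>"
    unfolding inf_represents_def acc inf by auto
qed

section \<open>Monotonicity, right-continuity and the dual formula\<close>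

lemma mono_alpha_min: "mono (\<lambda>s. alpha_min \<psi> s \<phi>)"
proof (rule monoI)
  fix r s :: real assume "r \<le> s"
  then have "sublevel \<psi> r \<subseteq> sublevel \<psi> s" by (auto simp: sublevel_def intro: le_ereal_le)
  then show "alpha_min \<psi> r \<phi> \<le> alpha_min \<psi> s \<phi>"
    unfolding alpha_min_def by (rule SUP_subset_mono) simp
qed

lemma mono_alpha_min_plus: "mono (\<lambda>s. alpha_min_plus \<psi> s \<phi>)"
  unfolding alpha_min_plus_def by (intro monoI INF_superset_mono) auto

lemma le_alpha_min_plus_iff:
  "a \<le> alpha_min_plus \<psi> s \<phi> \<longleftrightarrow> (\<forall>t>s. a \<le> alpha_min \<psi> t \<phi>)"
  unfolding alpha_min_plus_def le_INF_iff greaterThan_iff Ball_def ..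

text \<open>A Galois connection between levels s and values t. If the infimum is at most s, each r >
  s lies above some admissible u, which bounds \<open>alpha_min\<close> at r from below; letting r
  range over all reals above s makes s itself admissible.\<close>

lemma G_fun_le_iff: "G_fun \<psi> t \<phi> \<le> ereal s \<longleftrightarrow> ereal t \<le> alpha_min_plus \<psi> s \<phi>"
proof
  assume G: "G_fun \<psi> t \<phi> \<le> ereal s"
  show "ereal t \<le> alpha_min_plus \<psi> s \<phi>"
    unfolding le_alpha_min_plus_iff
  proof (intro allI impI)
    fix r assume "s < r"
    then have "G_fun \<psi> t \<phi> < ereal r" by (intro le_less_trans[OF G]) simp
    then obtain u where "u < r" "ereal t \<le> alpha_min_plus \<psi> u \<phi>"
      unfolding G_fun_def INF_less_iff by auto
    then show "ereal t \<le> alpha_min \<psi> r \<phi>" by (simp add: le_alpha_min_plus_iff)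
  qed
qed (auto simp: G_fun_def intro: INF_lower)

text \<open>An extended real is determined by its real upper bounds, and \<open>G_fun_le_iff\<close>
  turns the real upper bounds of the supremum into the condition defining
  \<open>represents_sublevels\<close>.\<close>

lemma represents_sublevels_alpha_min_plus_iff:
  "represents_sublevels \<Phi> (alpha_min_plus \<psi>) \<psi> \<longleftrightarrow>
     (\<forall>x. \<psi> x = (SUP \<phi>\<in>\<Phi>. G_fun \<psi> (\<phi> x) \<phi>))"
proof -
  have "(\<psi> x = g) \<longleftrightarrow> (\<forall>s. \<psi> x \<le> ereal s \<longleftrightarrow> g \<le> ereal s)" for x g
    by (metis antisym ereal_le_real)
  then show ?thesis
    by (auto simp: represents_sublevels_def sublevel_def SUP_le_iff G_fun_le_iff)
qed

section \<open>Stability, directedness and monotonicity\<close>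

text \<open>When A consists of the points below \<alpha>, the premise on Y in countable stability
  says that Y lies in A, and the conclusion on y' says that y' lies in A.\<close>

lemma countably_stable_sublevel_iff:
  assumes "\<And>x. x \<in> A \<longleftrightarrow> (\<forall>\<phi>\<in>\<Phi>. ereal (\<phi> x) \<le> \<alpha> \<phi>)"
  shows "countably_stable \<Phi> \<alpha> \<longleftrightarrow> countably_upwards_directed \<Phi> A"
proof -
  have "(\<forall>\<phi>\<in>\<Phi>. (SUP y\<in>Y. ereal (\<phi> y)) \<le> \<alpha> \<phi>) \<longleftrightarrow> Y \<subseteq> A" for Y
    unfolding SUP_le_iff subset_iff assms by blast
  then show ?thesis
    unfolding countably_stable_def countably_upwards_directed_def assms[symmetric] by meson
qed

lemma represents_sublevels_stable_iff:
  assumes "represents_sublevels \<Phi> \<alpha> \<psi>"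
  shows "countably_stable_snd \<Phi> \<alpha> \<longleftrightarrow> (\<forall>s. countably_upwards_directed \<Phi> (sublevel \<psi> s))"
proof -
  have "countably_stable \<Phi> (\<alpha> s) \<longleftrightarrow> countably_upwards_directed \<Phi> (sublevel \<psi> s)" for s
    using assms by (intro countably_stable_sublevel_iff) (simp add: represents_sublevels_def)
  then show ?thesis by (simp add: countably_stable_snd_def)
qed

text \<open>Lying below \<open>\<alpha> s\<close> is inherited by smaller points of the preorder, so
  every sublevel set is downward closed.\<close>

lemma represents_sublevels_imp_monotone:
  assumes "represents_sublevels \<Phi> \<alpha> \<psi>"
  shows "monotone_wrt \<Phi> \<psi>"
  unfolding monotone_wrt_def
proof (intro allI impI)
  fix x y assume le: "induced_le \<Phi> x y"
  show "\<psi> x \<le> \<psi> y"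
  proof (rule ereal_le_real)
    fix s assume "\<psi> y \<le> ereal s"
    then have "\<forall>\<phi>\<in>\<Phi>. ereal (\<phi> y) \<le> \<alpha> s \<phi>"
      using assms by (simp add: represents_sublevels_def sublevel_def)
    then have "\<forall>\<phi>\<in>\<Phi>. ereal (\<phi> x) \<le> \<alpha> s \<phi>"
      using le unfolding induced_le_def by (meson ereal_less_eq(3) order_trans)
    then show "\<psi> x \<le> ereal s"
      using assms by (simp add: represents_sublevels_def sublevel_def)
  qed
qed

lemma represents_sublevels_alpha_min:
  assumes ne: "\<Phi> \<noteq> {}" and T: "topspace T = \<Phi>" and sc: "second_countable T"
    and lsc: "\<And>x. lower_semicontinuous_map T (\<lambda>\<phi>. \<phi> x)"
    and mono: "monotone_wrt \<Phi> \<psi>"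
    and dir: "\<And>s. countably_upwards_directed \<Phi> (sublevel \<psi> s)"
  shows "represents_sublevels \<Phi> (alpha_min \<psi>) \<psi>"
  unfolding represents_sublevels_def
proof (intro allI iffI)
  fix s x assume le: "\<forall>\<phi>\<in>\<Phi>. ereal (\<phi> x) \<le> alpha_min \<psi> s \<phi>"
  \<comment> \<open>The points y serve as indices and \<phi> as the variable, so a single Y works
    for all \<phi> simultaneously.\<close>
  obtain Y where Y: "Y \<subseteq> sublevel \<psi> s" "countable Y"
    and sup: "\<And>\<phi>. \<phi> \<in> topspace T \<Longrightarrow>
      (SUP y\<in>sublevel \<psi> s. ereal (\<phi> y)) = (SUP y\<in>Y. ereal (\<phi> y))"
    using countable_subset_same_SUP[of T "\<lambda>y \<phi>. \<phi> y" "sublevel \<psi> s"] sc lsc by blast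
  have leY: "ereal (\<phi> x) \<le> (SUP y\<in>Y. ereal (\<phi> y))" if "\<phi> \<in> \<Phi>" for \<phi>
    using le sup that by (simp add: alpha_min_def T)
  \<comment> \<open>For empty Y the supremum in \<open>leY\<close> would be -\<infinity>, below the
    real \<phi> x for any \<phi> in the nonempty \<Phi>. This also rules out an empty sublevel
    set.\<close>
  have "Y \<noteq> {}" using ne leY by (fastforce simp: bot_ereal_def)
  then obtain y' where y': "y' \<in> sublevel \<psi> s" "\<And>y. y \<in> Y \<Longrightarrow> induced_le \<Phi> y y'"
    using dir Y unfolding countably_upwards_directed_def by meson
  have "\<phi> x \<le> \<phi> y'" if "\<phi> \<in> \<Phi>" for \<phi>
  proof -
    have "(SUP y\<in>Y. ereal (\<phi> y)) \<le> ereal (\<phi> y')"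
      using y'(2) that by (intro SUP_least) (simp add: induced_le_def)
    then show ?thesis using leY[OF that] by (metis ereal_less_eq(3) order_trans)
  qed
  then have "\<psi> x \<le> \<psi> y'" using mono by (simp add: monotone_wrt_def induced_le_def)
  then show "x \<in> sublevel \<psi> s" using y'(1) by (simp add: sublevel_def)
qed (auto simp: alpha_min_def intro: SUP_upper)

text \<open>\<open>sublevel \<psi> s\<close> is the intersection of the sublevel sets at all t > s,
  and lying below \<open>alpha_min_plus\<close> at s means lying below \<open>alpha_min\<close> at
  all those t.\<close>

lemma represents_sublevels_alpha_min_plus:
  assumes "represents_sublevels \<Phi> (alpha_min \<psi>) \<psi>"
  shows "represents_sublevels \<Phi> (alpha_min_plus \<psi>) \<psi>"
  unfolding represents_sublevels_def
proof (intro allI)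
  fix s x
  have "x \<in> sublevel \<psi> s \<longleftrightarrow> (\<forall>t>s. x \<in> sublevel \<psi> t)"
  proof
    assume "\<forall>t>s. x \<in> sublevel \<psi> t"
    then have "\<psi> x \<le> ereal s + ereal e" if "e > 0" for e
      using that by (simp add: sublevel_def)
    then show "x \<in> sublevel \<psi> s" unfolding sublevel_def by (auto intro: ereal_le_epsilon2)
  qed (auto simp: sublevel_def intro: le_ereal_le)
  then show "x \<in> sublevel \<psi> s \<longleftrightarrow> (\<forall>\<phi>\<in>\<Phi>. ereal (\<phi> x) \<le> alpha_min_plus \<psi> s \<phi>)"
    using assms by (auto simp: represents_sublevels_def le_alpha_min_plus_iff)
qed

theorem theorem4p1:
  fixes \<Phi> :: "('a \<Rightarrow> real) set"
    and T :: "('a \<Rightarrow> real) topology"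
    and \<psi> :: "'a \<Rightarrow> ereal"
  assumes Phi_nonempty: "\<Phi> \<noteq> {}"
    and topspace_T: "topspace T = \<Phi>"
    and polish: "polish_topology T"
    and lsc: "\<And>x. lower_semicontinuous_map T (\<lambda>\<phi>. \<phi> x)"
    and psi_range: "\<And>x. \<psi> x \<noteq> -\<infinity>"
  defines "stmt_i \<equiv> monotone_wrt \<Phi> \<psi> \<and> (\<forall>s. countably_upwards_directed \<Phi> (sublevel \<psi> s))"
    and "stmt_ii \<equiv> \<exists>\<alpha> :: real \<Rightarrow> ('a \<Rightarrow> real) \<Rightarrow> ereal.
           (\<forall>\<phi>\<in>\<Phi>. mono (\<lambda>s. \<alpha> s \<phi>)) \<and> countably_stable_snd \<Phi> \<alpha> \<and> inf_represents \<Phi> \<alpha> \<psi>"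
    and "stmt_iii \<equiv> countably_stable_snd \<Phi> (alpha_min \<psi>) \<and> inf_represents \<Phi> (alpha_min \<psi>) \<psi>"
    and "stmt_iv \<equiv> countably_stable_snd \<Phi> (alpha_min_plus \<psi>) \<and>
           inf_represents \<Phi> (alpha_min_plus \<psi>) \<psi>"
    and "stmt_v \<equiv> countably_stable_snd \<Phi> (alpha_min_plus \<psi>) \<and>
           (\<forall>x. \<psi> x = (SUP \<phi>\<in>\<Phi>. G_fun \<psi> (\<phi> x) \<phi>))"
  shows "(stmt_i \<longleftrightarrow> stmt_ii) \<and> (stmt_ii \<longleftrightarrow> stmt_iii) \<and>
         (stmt_iii \<longleftrightarrow> stmt_iv) \<and> (stmt_iv \<longleftrightarrow> stmt_v)"
proof -
  have sc: "second_countable T"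
    using polish metrizable_separable_imp_second_countable
      completely_metrizable_imp_metrizable_space
    unfolding polish_topology_def by blast
  have inf: "inf_represents \<Phi> \<alpha> \<psi> \<longleftrightarrow> represents_sublevels \<Phi> \<alpha> \<psi>"
    if "\<forall>\<phi>\<in>\<Phi>. mono (\<lambda>s. \<alpha> s \<phi>)" for \<alpha>
    using that psi_range by (rule inf_represents_iff_represents_sublevels)
  \<comment> \<open>Any stable representing \<alpha> yields (i), which handles the implications from
    (ii), (iii) and (iv) together.\<close>
  have i_of: stmt_i if "countably_stable_snd \<Phi> \<alpha>" "represents_sublevels \<Phi> \<alpha> \<psi>" for \<alpha>
    using that represents_sublevels_stable_iff represents_sublevels_imp_monotone
    unfolding stmt_i_def by blast
  have iii_iff: "stmt_iii \<longleftrightarrow>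
      countably_stable_snd \<Phi> (alpha_min \<psi>) \<and> represents_sublevels \<Phi> (alpha_min \<psi>) \<psi>"
    unfolding stmt_iii_def using inf mono_alpha_min by blast
  have iv_iff: "stmt_iv \<longleftrightarrow>
      countably_stable_snd \<Phi> (alpha_min_plus \<psi>) \<and> represents_sublevels \<Phi> (alpha_min_plus \<psi>) \<psi>"
    unfolding stmt_iv_def using inf mono_alpha_min_plus by blast
  have min: "represents_sublevels \<Phi> (alpha_min \<psi>) \<psi>" if stmt_i
    using that represents_sublevels_alpha_min[OF Phi_nonempty topspace_T sc lsc]
    unfolding stmt_i_def by blast
  \<comment> \<open>Once \<open>min\<close> provides the representation, stability of
    \<open>alpha_min\<close> is the directedness of the sublevel sets assumed in (i).\<close>
  have "stmt_i \<longleftrightarrow> stmt_iii"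
    using i_of min represents_sublevels_stable_iff unfolding iii_iff stmt_i_def by blast
  moreover have "stmt_i \<longleftrightarrow> stmt_iv"
    using i_of min represents_sublevels_alpha_min_plus represents_sublevels_stable_iff
    unfolding iv_iff stmt_i_def by blast
  moreover have "stmt_iii \<Longrightarrow> stmt_ii"
    unfolding stmt_ii_def stmt_iii_def using mono_alpha_min by blast
  moreover have "stmt_ii \<Longrightarrow> stmt_i"
    using i_of inf unfolding stmt_ii_def by blast
  moreover have "stmt_iv \<longleftrightarrow> stmt_v"
    unfolding iv_iff stmt_v_def represents_sublevels_alpha_min_plus_iff ..
  ultimately show ?thesis by blast
qed

end
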